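(* Let $V=(\mathbb{R}^n,\langle\cdot,\cdot\rangle)$ be the standard pseudo-Euclidean vector space of signature $(k,l)$, $n=k+l$, and let $$\mathcal{C}(V):=\{\eta\in\Lambda^3V \mid \Sigma_\eta \text{ is (totally) isotropic}\}.$$ Then $\mathcal{C}(V)=\bigcup_{L\subset V}\Lambda^3L$, where the union runs over all maximal isotropic subspaces $L\subset V$. Each $\eta\in\mathcal{C}(V)$ defines a 2-step nilpotent subgroup $\mathcal{L}(\eta)\subset\mathrm{Isom}(V)$ which acts simply transitively on $V$. Moreover, for $\eta,\eta'\in\mathcal{C}(V)$, the subgroups $\mathcal{L}(\eta),\mathcal{L}(\eta')\subset\mathrm{Isom}(V)$ are conjugate in $\mathrm{Isom}(V)$ if and only if $\eta'=g\cdot\eta$ for some $g\in O(V)$.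
   Context: Using the scalar product, $V\cong V^*$ and $\Lambda^2V\cong\mathfrak{so}(V)$, so $\Lambda^3V\subset V^*\otimes\mathfrak{so}(V)$: a three-vector $\eta\in\Lambda^3V$ is regarded as an alternating trilinear form on $V$ and, for $X\in V$, $\eta_X\in\mathfrak{so}(V)$ is the skew-symmetric endomorphism with $\langle\eta_XY,Z\rangle=\eta(X,Y,Z)$. The support of $\eta$ is $\Sigma_\eta:=\mathrm{span}\{\eta_XY\mid X,Y\in V\}\subset V$. A subspace is (totally) isotropic if $\langle\cdot,\cdot\rangle$ vanishes on it. $\mathrm{Isom}(V)$ is the group of isometries of the pseudo-Riemannian manifold $V$, i.e. the group of affine maps $x\mapsto Ax+v$ with $A\in O(V)$, $v\in V$. For $\eta\in\mathcal{C}(V)$, the group is $$\mathcal{L}(\eta):=\{g_X\mid X\in V\},\qquad g_X:=\exp\begin{pmatrix}\eta_X&X\\0&0\end{pmatrix}=\begin{pmatrix}\mathbb{1}+\eta_X&X\\0&1\end{pmatrix},$$ acting on $V\cong V\times\{1\}\subset V\times\mathbb{R}$, i.e. $g_X(x)=(\mathbb{1}+\eta_X)x+X$. The action of $O(V)$ on $\Lambda^3V$ is the natural one, $(g\cdot\eta)_X=g\,\eta_{g^{-1}X}\,g^{-1}$. "2-step nilpotent" means that all commutators are central (Abelian groups are included). *)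

theory Defs
  imports "HOL-Analysis.Analysis" "HOL-Algebra.Generated_Groups"
begin

text \<open>
  The vector space \<open>V\<close> is \<^typ>\<open>real^'n\<close>. The scalar product is diagonal with entries \<open>+1\<close> at the
  coordinates in \<open>P\<close> and \<open>-1\<close> at the others, so its signature is \<open>(card P, card (- P))\<close>.
  The index type carries no order, so no set of coordinates is distinguished as the first ones.
\<close>

definition sprod :: "'n::finite set \<Rightarrow> real^'n \<Rightarrow> real^'n \<Rightarrow> real"
  where "sprod P x y = (\<Sum>i\<in>P. x $ i * y $ i) - (\<Sum>i\<in>- P. x $ i * y $ i)"

definition isotropic :: "'n::finite set \<Rightarrow> (real^'n) set \<Rightarrow> bool"
  where "isotropic P L \<longleftrightarrow> subspace L \<and> (\<forall>x\<in>L. \<forall>y\<in>L. sprod P x y = 0)"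

definition maximal_isotropic :: "'n::finite set \<Rightarrow> (real^'n) set \<Rightarrow> bool"
  where "maximal_isotropic P L \<longleftrightarrow>
    isotropic P L \<and> (\<forall>M. isotropic P M \<and> L \<subseteq> M \<longrightarrow> M = L)"

type_synonym 'n trilin = "real^'n \<Rightarrow> real^'n \<Rightarrow> real^'n \<Rightarrow> real"

definition three_vectors :: "'n::finite trilin set"
  where "three_vectors = {\<eta>.
    (\<forall>Y Z. linear (\<lambda>X. \<eta> X Y Z)) \<and> (\<forall>X Z. linear (\<lambda>Y. \<eta> X Y Z)) \<and> (\<forall>X Y. linear (\<lambda>Z. \<eta> X Y Z)) \<and>
    (\<forall>X Y. \<eta> X X Y = 0 \<and> \<eta> X Y Y = 0 \<and> \<eta> X Y X = 0)}"

text \<open>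
  The decomposable three-vector \<open>x \<and> y \<and> z\<close> as a trilinear form, by means of the scalar product.
  \<open>Lambda3 P L\<close> is the linear span of those with factors in \<open>L\<close>, written as finite linear
  combinations. For \<open>L = V\<close> it is the space of all three-vectors; see \<open>Lambda3_UNIV\<close> below.
\<close>

definition wedge3 :: "'n::finite set \<Rightarrow> real^'n \<Rightarrow> real^'n \<Rightarrow> real^'n \<Rightarrow> 'n trilin"
  where "wedge3 P x y z = (\<lambda>X Y Z. det (vector
    [vector [sprod P x X, sprod P x Y, sprod P x Z],
     vector [sprod P y X, sprod P y Y, sprod P y Z],
     vector [sprod P z X, sprod P z Y, sprod P z Z]] :: real^3^3))"

definition Lambda3 :: "'n::finite set \<Rightarrow> (real^'n) set \<Rightarrow> 'n trilin set"
  where "Lambda3 P L = {\<eta>. \<exists>(m::nat) c x y z.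
    (\<forall>i<m. x i \<in> L \<and> y i \<in> L \<and> z i \<in> L) \<and>
    \<eta> = (\<lambda>X Y Z. \<Sum>i<m. c i * wedge3 P (x i) (y i) (z i) X Y Z)}"

text \<open>
  \<open>endo P \<eta> X\<close> is the skew-symmetric endomorphism \<open>\<eta>\<^sub>X\<close>; existence and uniqueness of the
  vector are given by \<open>riesz_sprod\<close>, and \<open>sprod_endo\<close> is the defining equation.
\<close>

definition endo :: "'n::finite set \<Rightarrow> 'n trilin \<Rightarrow> real^'n \<Rightarrow> real^'n \<Rightarrow> real^'n"
  where "endo P \<eta> X Y = (THE v. \<forall>Z. sprod P v Z = \<eta> X Y Z)"

definition supp :: "'n::finite set \<Rightarrow> 'n trilin \<Rightarrow> (real^'n) set"
  where "supp P \<eta> = span {endo P \<eta> X Y |X Y. True}"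

definition CV :: "'n::finite set \<Rightarrow> 'n trilin set"
  where "CV P = {\<eta> \<in> three_vectors. isotropic P (supp P \<eta>)}"

definition pseudo_orthogonal :: "'n::finite set \<Rightarrow> (real^'n \<Rightarrow> real^'n) set"
  where "pseudo_orthogonal P = {A. linear A \<and> (\<forall>x y. sprod P (A x) (A y) = sprod P x y)}"

text \<open>
  The isometries of \<open>V\<close> as a flat pseudo-Riemannian manifold are the affine maps with
  linear part in \<open>O(V)\<close>.
\<close>

definition Isom :: "'n::finite set \<Rightarrow> (real^'n \<Rightarrow> real^'n) monoid"
  where "Isom P = \<lparr>carrier = {\<lambda>x. A x + v |A v. A \<in> pseudo_orthogonal P}, mult = (\<circ>), one = id\<rparr>"

text \<open>
  The natural action by pull-back along the inverse; \<open>endo_act\<close> below expresses it through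
  the endomorphisms as \<open>(g \<cdot> \<eta>)\<^sub>X = g \<eta>\<^bsub>g\<^sup>-\<^sup>1X\<^esub> g\<^sup>-\<^sup>1\<close>.
\<close>

definition act :: "(real^'n \<Rightarrow> real^'n) \<Rightarrow> 'n::finite trilin \<Rightarrow> 'n trilin"
  where "act g \<eta> = (\<lambda>X Y Z. \<eta> (Hilbert_Choice.inv g X) (Hilbert_Choice.inv g Y) (Hilbert_Choice.inv g Z))"

text \<open>
  The exponential series of an endomorphism, evaluated pointwise, since the type of functions
  does not carry the structure of a normed algebra.
\<close>

definition exp_endo :: "('a::real_normed_vector \<Rightarrow> 'a) \<Rightarrow> 'a \<Rightarrow> 'a"
  where "exp_endo M v = (\<Sum>m. (M ^^ m) v /\<^sub>R fact m)"

definition block :: "'n::finite set \<Rightarrow> 'n trilin \<Rightarrow> real^'n \<Rightarrow> (real^'n) \<times> real \<Rightarrow> (real^'n) \<times> real"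
  where "block P \<eta> X = (\<lambda>(x, t). (endo P \<eta> X x + t *\<^sub>R X, 0))"

text \<open>
  The transformation of \<open>V\<close> induced by the exponential of the block matrix under the
  identification of \<open>V\<close> with \<open>V \<times> {1}\<close>; see \<open>exp_block\<close> and \<open>gmap_eq\<close> below.
\<close>

definition gmap :: "'n::finite set \<Rightarrow> 'n trilin \<Rightarrow> real^'n \<Rightarrow> real^'n \<Rightarrow> real^'n"
  where "gmap P \<eta> X x = fst (exp_endo (block P \<eta> X) (x, 1))"

definition LL :: "'n::finite set \<Rightarrow> 'n trilin \<Rightarrow> (real^'n \<Rightarrow> real^'n) set"
  where "LL P \<eta> = range (gmap P \<eta>)"

text \<open>
  Abelian subgroups are included.
\<close>

definition two_step_nilpotent :: "('a, 'b) monoid_scheme \<Rightarrow> 'a set \<Rightarrow> bool"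
  where "two_step_nilpotent G H \<longleftrightarrow>
    (\<forall>c\<in>derived_set G H. \<forall>h\<in>H. c \<otimes>\<^bsub>G\<^esub> h = h \<otimes>\<^bsub>G\<^esub> c)"

definition simply_transitive :: "('a \<Rightarrow> 'a) set \<Rightarrow> bool"
  where "simply_transitive H \<longleftrightarrow> (\<forall>x y. \<exists>!g. g \<in> H \<and> g x = y)"

definition conjugate_in :: "('a, 'b) monoid_scheme \<Rightarrow> 'a set \<Rightarrow> 'a set \<Rightarrow> bool"
  where "conjugate_in G H K \<longleftrightarrow> (\<exists>g\<in>carrier G. K = (\<lambda>h. g \<otimes>\<^bsub>G\<^esub> h \<otimes>\<^bsub>G\<^esub> inv\<^bsub>G\<^esub> g) ` H)"


subsection \<open>Basic properties\<close>

lemma sprod_conv: "sprod P x y = (\<Sum>i\<in>UNIV. (if i \<in> P then 1 else -1) * (x $ i * y $ i))"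
proof -
  have "(\<Sum>i\<in>UNIV. (if i \<in> P then 1 else -1) * (x $ i * y $ i)) =
     (\<Sum>i\<in>P \<union> - P. (if i \<in> P then 1 else -1) * (x $ i * y $ i))" by simp
  also have "\<dots> = (\<Sum>i\<in>P. (if i \<in> P then 1 else -1) * (x $ i * y $ i)) +
      (\<Sum>i\<in>- P. (if i \<in> P then 1 else -1) * (x $ i * y $ i))"
    by (rule sum.union_disjoint) auto
  finally show ?thesis by (simp add: sprod_def sum_negf)
qed

lemma sprod_commute: "sprod P x y = sprod P y x"
  by (simp add: sprod_def mult.commute)

lemma linear_sprod_right: "linear (sprod P x)"
  by (rule linearI) (simp_all add: sprod_conv algebra_simps sum.distrib sum_distrib_left)

lemma linear_sprod_left: "linear (\<lambda>x. sprod P x y)"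
  using linear_sprod_right[of P y] by (simp add: sprod_commute[of P _ y])

lemma sprod_axis: "sprod P x (axis i 1) = (if i \<in> P then 1 else -1) * x $ i"
proof -
  have "(if j \<in> P then 1 else -1) * (x $ j * axis i 1 $ j) =
      (if j = i then (if i \<in> P then 1 else -1) * x $ i else 0)" for j
    by (auto simp: axis_def)
  then show ?thesis by (simp add: sprod_conv)
qed

lemma sprod_nondegenerate:
  assumes "\<And>z. sprod P x z = sprod P y z" shows "x = y"
proof -
  have "x $ i = y $ i" for i
    using assms[of "axis i 1"] by (simp add: sprod_axis split: if_splits)
  then show ?thesis by (simp add: vec_eq_iff)
qed

lemma linear_expand:
  fixes f :: "real^'n::finite \<Rightarrow> real"
  assumes "linear f" shows "f x = (\<Sum>i\<in>UNIV. x $ i * f (axis i 1))"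
proof -
  have "f x = f (\<Sum>i\<in>UNIV. x $ i *s axis i 1)"
    by (simp add: basis_expansion)
  also have "\<dots> = (\<Sum>i\<in>UNIV. x $ i * f (axis i 1))"
    using assms by (simp add: linear_sum linear_cmul scalar_mult_eq_scaleR)
  finally show ?thesis .
qed

lemma riesz_sprod:
  assumes "linear f" shows "\<exists>!v. \<forall>z. sprod P v z = f z"
proof (rule ex_ex1I)
  let ?v = "\<chi> i. (if i \<in> P then 1 else -1) * f (axis i 1)"
  have "sprod P ?v z = f z" for z
    unfolding linear_expand[OF assms, of z] sprod_conv by (rule sum.cong) auto
  then show "\<exists>v. \<forall>z. sprod P v z = f z" by blast
qed (metis sprod_nondegenerate)

lemma sprod_endo:
  assumes "\<eta> \<in> three_vectors" shows "sprod P (endo P \<eta> X Y) Z = \<eta> X Y Z"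
proof -
  have "linear (\<lambda>Z. \<eta> X Y Z)" using assms by (simp add: three_vectors_def)
  from theI'[OF riesz_sprod[OF this, of P]] show ?thesis by (simp add: endo_def)
qed

lemma linear_wedge3:
  "linear (\<lambda>X. wedge3 P x y z X Y Z)" "linear (\<lambda>Y. wedge3 P x y z X Y Z)" "linear (\<lambda>Z. wedge3 P x y z X Y Z)"
  by (rule linearI; simp add: wedge3_def det_3 linear_add[OF linear_sprod_right]
      linear_cmul[OF linear_sprod_right] algebra_simps)+

lemma Lambda3_UNIV: "Lambda3 P UNIV = three_vectors"
proof
  show "Lambda3 P UNIV \<subseteq> three_vectors"
  proof
    fix \<eta> assume "\<eta> \<in> Lambda3 P UNIV"
    then obtain m :: nat and c x y z
      where \<eta>: "\<eta> = (\<lambda>X Y Z. \<Sum>i<m. c i * wedge3 P (x i) (y i) (z i) X Y Z)"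
      by (auto simp: Lambda3_def)
    have "linear (\<lambda>X. c * f X)" if "linear f" for c and f :: "real^'a \<Rightarrow> real"
      using linear_compose_scale_right[OF that, of c] by simp
    then have "linear (\<lambda>X. \<eta> X Y Z)" "linear (\<lambda>Y. \<eta> X Y Z)" "linear (\<lambda>Z. \<eta> X Y Z)" for X Y Z
      unfolding \<eta> by (intro linear_compose_sum ballI; simp add: linear_wedge3)+
    moreover have "\<eta> X X Y = 0" "\<eta> X Y Y = 0" "\<eta> X Y X = 0" for X Y
      unfolding \<eta> by (rule sum.neutral; simp add: wedge3_def det_3 algebra_simps)+
    ultimately show "\<eta> \<in> three_vectors" by (simp add: three_vectors_def)
  qed
  show "three_vectors \<subseteq> Lambda3 P UNIV"
  proof
    fix \<eta> :: "'a trilin" assume \<eta>: "\<eta> \<in> three_vectors"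
    have lin: "linear (\<lambda>X. \<eta> X Y Z)" "linear (\<lambda>Y. \<eta> X Y Z)" "linear (\<lambda>Z. \<eta> X Y Z)"
      and alt: "\<eta> X X Y = 0" "\<eta> X Y Y = 0" "\<eta> X Y X = 0" for X Y Z
      using \<eta> by (auto simp: three_vectors_def)
    have s1: "\<eta> Y X Z = - \<eta> X Y Z" for X Y Z
      using alt(1)[of "X + Y" Z] alt(1)[of X Z] alt(1)[of Y Z]
      by (simp add: linear_add[OF lin(1)] linear_add[OF lin(2)])
    have s2: "\<eta> X Z Y = - \<eta> X Y Z" for X Y Z
      using alt(2)[of X "Y + Z"] alt(2)[of X Z] alt(2)[of X Y]
      by (simp add: linear_add[OF lin(2)] linear_add[OF lin(3)])
    let ?e = "\<lambda>i::'a. axis i 1 :: real^'a"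
    let ?s = "\<lambda>i. if i \<in> P then 1 else -1 :: real"
    define h where "h = (\<lambda>(i, j, k). \<eta> (?e i) (?e j) (?e k))"
    have ex: "(\<Sum>(i, j, k)\<in>UNIV. h (i, j, k) * (X $ i * Y $ j * Z $ k)) = \<eta> X Y Z" for X Y Z
    proof -
      have "\<eta> X Y Z = (\<Sum>i\<in>UNIV. X $ i * (\<Sum>j\<in>UNIV. Y $ j * (\<Sum>k\<in>UNIV. Z $ k * h (i, j, k))))"
        by (subst linear_expand[OF lin(1)], subst linear_expand[OF lin(2)],
            subst linear_expand[OF lin(3)]) (simp add: h_def)
      also have "\<dots> = (\<Sum>(i, j, k)\<in>UNIV \<times> UNIV \<times> UNIV. h (i, j, k) * (X $ i * Y $ j * Z $ k))"
        by (simp add: sum.cartesian_product[symmetric] sum_distrib_left mult_ac del: UNIV_Times_UNIV)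
      finally show ?thesis by simp
    qed
    define c where "c = (\<lambda>(i, j, k). ?s i * ?s j * ?s k * h (i, j, k) / 6)"
    define w where "w = (\<lambda>(i, j, k). wedge3 P (?e i) (?e j) (?e k))"
    have cw: "c p * w p X Y Z = (case p of (i, j, k) \<Rightarrow>
        (h (i, j, k) * (X $ i * Y $ j * Z $ k) + h (i, j, k) * (Y $ i * Z $ j * X $ k)
       + h (i, j, k) * (Z $ i * X $ j * Y $ k) - h (i, j, k) * (X $ i * Z $ j * Y $ k)
       - h (i, j, k) * (Y $ i * X $ j * Z $ k) - h (i, j, k) * (Z $ i * Y $ j * X $ k)) / 6)" for p X Y Z
    proof -
      obtain i j k where p: "p = (i, j, k)" by (cases p)
      have "sprod P (?e i) x = ?s i * x $ i" for i x by (simp add: sprod_commute[of P "?e i"] sprod_axis)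
      then show ?thesis
        by (simp add: p c_def w_def wedge3_def det_3 algebra_simps)
    qed
    have sum: "(\<Sum>p\<in>UNIV. c p * w p X Y Z) = \<eta> X Y Z" for X Y Z
    proof -
      have "(\<Sum>p\<in>UNIV. c p * w p X Y Z) =
          (\<eta> X Y Z + \<eta> Y Z X + \<eta> Z X Y - \<eta> X Z Y - \<eta> Y X Z - \<eta> Z Y X) / 6"
        unfolding cw ex[symmetric]
        by (simp add: split_beta sum.distrib sum_subtractf sum_divide_distrib[symmetric])
      moreover have "\<eta> Y Z X = \<eta> X Y Z" "\<eta> Z X Y = \<eta> X Y Z" "\<eta> Z Y X = - \<eta> X Y Z"
        using s1[of X Y Z] s2[of X Y Z] s1[of X Z Y] s2[of Y X Z] s1[of Y Z X] by linarith+
      ultimately show ?thesis using s1[of Y X Z] s2[of X Z Y] by simp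
    qed
    obtain b where b: "bij_betw b {0..<CARD('a \<times> 'a \<times> 'a)} (UNIV :: ('a \<times> 'a \<times> 'a) set)"
      using ex_bij_betw_nat_finite[OF finite] by blast
    let ?m = "CARD('a \<times> 'a \<times> 'a)"
    have "\<eta> = (\<lambda>X Y Z. \<Sum>q<?m. c (b q) * wedge3 P (?e (fst (b q))) (?e (fst (snd (b q))))
        (?e (snd (snd (b q)))) X Y Z)"
    proof (intro ext)
      fix X Y Z
      have "\<eta> X Y Z = (\<Sum>p\<in>UNIV. c p * w p X Y Z)" by (simp only: sum)
      also have "\<dots> = (\<Sum>q\<in>{0..<?m}. c (b q) * w (b q) X Y Z)"
        by (rule sum.reindex_bij_betw[OF b, symmetric])
      finally show "\<eta> X Y Z = (\<Sum>q<?m. c (b q) * wedge3 P (?e (fst (b q))) (?e (fst (snd (b q))))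
        (?e (snd (snd (b q)))) X Y Z)"
        by (simp only: w_def split_beta atLeast0LessThan)
    qed
    then show "\<eta> \<in> Lambda3 P UNIV" unfolding Lambda3_def
      by (intro CollectI exI[of _ ?m] exI[of _ "\<lambda>q. c (b q)"] exI[of _ "\<lambda>q. ?e (fst (b q))"]
          exI[of _ "\<lambda>q. ?e (fst (snd (b q)))"] exI[of _ "\<lambda>q. ?e (snd (snd (b q)))"] conjI) simp_all
  qed
qed

lemma pseudo_orthogonal_bij:
  assumes "A \<in> pseudo_orthogonal P" shows "bij A"
proof -
  have A: "linear A" "\<And>x y. sprod P (A x) (A y) = sprod P x y"
    using assms by (auto simp: pseudo_orthogonal_def)
  have "inj A" by (rule injI) (metis A(2) sprod_nondegenerate)
  then show ?thesis
    using A(1) linear_injective_imp_surjective by (auto simp: bij_def)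
qed

lemma pseudo_orthogonal_inv:
  assumes "A \<in> pseudo_orthogonal P" shows "Hilbert_Choice.inv A \<in> pseudo_orthogonal P"
proof -
  have A: "linear A" "\<And>x y. sprod P (A x) (A y) = sprod P x y"
    using assms by (auto simp: pseudo_orthogonal_def)
  have b: "bij A" by (rule pseudo_orthogonal_bij[OF assms])
  then have i: "A (Hilbert_Choice.inv A x) = x" for x by (simp add: bij_is_surj surj_f_inv_f)
  have "linear (Hilbert_Choice.inv A)"
    using A(1) b by (simp add: inj_linear_imp_inv_linear bij_is_inj)
  moreover have "sprod P (Hilbert_Choice.inv A x) (Hilbert_Choice.inv A y) = sprod P x y" for x y
    by (metis A(2) i)
  ultimately show ?thesis by (simp add: pseudo_orthogonal_def)
qed

lemma group_Isom: "group (Isom P)"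
proof (rule groupI)
  fix f g assume "f \<in> carrier (Isom P)" "g \<in> carrier (Isom P)"
  then obtain A v B w where A: "A \<in> pseudo_orthogonal P" "f = (\<lambda>x. A x + v)"
    and B: "B \<in> pseudo_orthogonal P" "g = (\<lambda>x. B x + w)" by (auto simp: Isom_def)
  have "A \<circ> B \<in> pseudo_orthogonal P"
    using A(1) B(1) by (auto simp: pseudo_orthogonal_def linear_compose)
  moreover have "f \<circ> g = (\<lambda>x. (A \<circ> B) x + (A w + v))"
    using A B by (auto simp: pseudo_orthogonal_def linear_add fun_eq_iff)
  ultimately show "f \<otimes>\<^bsub>Isom P\<^esub> g \<in> carrier (Isom P)"
    unfolding Isom_def by (simp del: o_apply) blast
next
  have "id \<in> pseudo_orthogonal P" by (simp add: pseudo_orthogonal_def linear_id)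
  then have "(\<lambda>x. id x + 0) \<in> carrier (Isom P)" unfolding Isom_def monoid.simps partial_object.simps by blast
  then show "\<one>\<^bsub>Isom P\<^esub> \<in> carrier (Isom P)" by (simp add: Isom_def id_def)
next
  fix f assume "f \<in> carrier (Isom P)"
  then obtain A v where A: "A \<in> pseudo_orthogonal P" "f = (\<lambda>x. A x + v)" by (auto simp: Isom_def)
  let ?B = "Hilbert_Choice.inv A"
  have B: "?B \<in> pseudo_orthogonal P" by (rule pseudo_orthogonal_inv[OF A(1)])
  then have "linear ?B" by (simp add: pseudo_orthogonal_def)
  moreover have "inj A" using pseudo_orthogonal_bij[OF A(1)] by (simp add: bij_is_inj)
  ultimately have "(\<lambda>x. ?B x + - ?B v) \<circ> f = id"
    by (auto simp: A(2) linear_add fun_eq_iff)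
  moreover have "(\<lambda>x. ?B x + - ?B v) \<in> carrier (Isom P)"
    using B unfolding Isom_def monoid.simps partial_object.simps by blast
  ultimately show "\<exists>g\<in>carrier (Isom P). g \<otimes>\<^bsub>Isom P\<^esub> f = \<one>\<^bsub>Isom P\<^esub>"
    by (auto simp: Isom_def)
qed (auto simp: Isom_def o_assoc)

lemma endo_act:
  assumes \<eta>: "\<eta> \<in> three_vectors" and g: "g \<in> pseudo_orthogonal P"
  shows "endo P (act g \<eta>) X Y = g (endo P \<eta> (Hilbert_Choice.inv g X) (Hilbert_Choice.inv g Y))"
proof -
  let ?h = "Hilbert_Choice.inv g"
  have h: "linear ?h" using pseudo_orthogonal_inv[OF g] by (simp add: pseudo_orthogonal_def)
  have i: "g (?h Z) = Z" for Z
    using pseudo_orthogonal_bij[OF g] by (simp add: bij_is_surj surj_f_inv_f)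
  have "act g \<eta> \<in> three_vectors"
    using \<eta> h unfolding three_vectors_def act_def
    by (auto intro: linear_compose[OF h, unfolded o_def])
  then have "sprod P (endo P (act g \<eta>) X Y) Z = sprod P (g (endo P \<eta> (?h X) (?h Y))) Z" for Z
  proof -
    have "sprod P (g (endo P \<eta> (?h X) (?h Y))) Z = sprod P (g (endo P \<eta> (?h X) (?h Y))) (g (?h Z))"
      by (simp add: i)
    also have "\<dots> = sprod P (endo P \<eta> (?h X) (?h Y)) (?h Z)"
      using g by (simp add: pseudo_orthogonal_def)
    finally show ?thesis
      using \<open>act g \<eta> \<in> three_vectors\<close> by (simp add: sprod_endo \<eta> act_def)
  qed
  then show ?thesis by (rule sprod_nondegenerate)
qed

lemma exp_endo_nilpotent:
  assumes "\<And>v. M (M v) = 0" "M 0 = 0" shows "exp_endo M v = v + M v"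
proof -
  have z: "(M ^^ m) v = 0" if "m \<notin> {..<2}" for m
  proof -
    from that have "2 \<le> m" by simp
    then obtain k where "m = Suc (Suc k)" by (auto simp: le_iff_add)
    then show ?thesis using assms by simp
  qed
  have "exp_endo M v = (\<Sum>m<2. (M ^^ m) v /\<^sub>R fact m)"
    unfolding exp_endo_def by (rule suminf_finite) (auto simp: z)
  then show ?thesis by (simp add: numeral_2_eq_2)
qed

lemma exp_block:
  assumes "\<eta> \<in> CV P"
  shows "exp_endo (block P \<eta> X) (x, t) = (x + endo P \<eta> X x + t *\<^sub>R X, t)"
proof -
  have \<eta>: "\<eta> \<in> three_vectors" and iso: "isotropic P (supp P \<eta>)"
    using assms by (auto simp: CV_def)
  have tri: "linear (\<lambda>Z. \<eta> X Y Z)" "linear (\<lambda>Y. \<eta> X Y Z)" "\<eta> X Y Y = 0" "\<eta> X X Y = 0" for X Y Z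
    using \<eta> by (auto simp: three_vectors_def)
  have e: "endo P \<eta> X Y \<in> supp P \<eta>" for X Y unfolding supp_def by (rule span_base) auto
  have skew: "\<eta> X Y Z = - \<eta> X Z Y" for X Y Z
  proof -
    have "\<eta> X (Y + Z) (Y + Z) = 0" by (rule tri(3))
    then have "\<eta> X Y (Y + Z) + \<eta> X Z (Y + Z) = 0" using linear_add[OF tri(2)] by metis
    then have "(\<eta> X Y Y + \<eta> X Y Z) + (\<eta> X Z Y + \<eta> X Z Z) = 0" using linear_add[OF tri(1)] by metis
    then show ?thesis by (simp add: tri(3))
  qed
  have "endo P \<eta> X (endo P \<eta> X Y + s *\<^sub>R X) = 0" for Y s
  proof (rule sprod_nondegenerate[of P])
    fix Z
    have "sprod P (endo P \<eta> X (endo P \<eta> X Y + s *\<^sub>R X)) Z =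
        \<eta> X (endo P \<eta> X Y) Z + s * \<eta> X X Z"
      by (simp add: sprod_endo \<eta> linear_add[OF tri(2)] linear_cmul[OF tri(2)])
    also have "\<dots> = - \<eta> X Z (endo P \<eta> X Y)" using skew[of X Z] by (simp add: tri(4))
    also have "\<dots> = - sprod P (endo P \<eta> X Z) (endo P \<eta> X Y)" by (simp add: sprod_endo \<eta>)
    also have "\<dots> = 0" using iso e by (simp add: isotropic_def)
    finally show "sprod P (endo P \<eta> X (endo P \<eta> X Y + s *\<^sub>R X)) Z = sprod P 0 Z"
      by (simp add: sprod_def)
  qed
  moreover from this[of 0 0] have "endo P \<eta> X 0 = 0"
  proof -
    show ?thesis
      by (rule sprod_nondegenerate[of P])
        (simp add: sprod_endo \<eta> linear_0[OF tri(2)], simp add: sprod_def)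
  qed
  ultimately have "exp_endo (block P \<eta> X) (x, t) = (x, t) + block P \<eta> X (x, t)"
    by (intro exp_endo_nilpotent) (auto simp: block_def zero_prod_def split: prod.splits)
  then show ?thesis by (simp add: block_def algebra_simps)
qed

lemma gmap_eq:
  assumes "\<eta> \<in> CV P" shows "gmap P \<eta> X x = x + endo P \<eta> X x + X"
  by (simp add: gmap_def exp_block[OF assms])

end

theory Submission
  imports Defs
begin

text \<open>
  Write \<open>e\<^sub>X Y\<close> for \<open>endo P \<eta> X Y\<close>. Isotropy of the support gives \<open>e\<^sub>X e\<^sub>Y = 0\<close>, hence also
  \<open>e\<^bsub>e\<^sub>X Y\<^esub> = 0\<close> by skew symmetry. So \<open>g\<^sub>X g\<^sub>Y = g\<^sub>Z\<close> with \<open>Z = X + Y + e\<^sub>X Y\<close>, the commutator of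
  \<open>g\<^sub>X\<close> and \<open>g\<^sub>Y\<close> is the central element with parameter \<open>2 e\<^sub>X Y\<close>, and \<open>g\<^sub>X x = y\<close> reads
  \<open>(1 - e\<^sub>x) X = y - x\<close>, where \<open>1 - e\<^sub>x\<close> has the inverse \<open>1 + e\<^sub>x\<close>.
  Translations normalize \<open>\<L>(\<eta>)\<close>, and a linear isometry \<open>A\<close> conjugates \<open>\<L>(\<eta>)\<close> to \<open>\<L>(A \<cdot> \<eta>)\<close>.
  As \<open>g\<^sub>X 0 = X\<close>, the set \<open>\<L>(\<eta>)\<close> determines \<open>\<eta>\<close>, which gives the conjugacy criterion.
\<close>

subsection \<open>Endomorphisms of a three-vector\<close>

lemma sprod_simps:
  "sprod P (x + y) z = sprod P x z + sprod P y z"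
  "sprod P x (y + z) = sprod P x y + sprod P x z"
  "sprod P (x - y) z = sprod P x z - sprod P y z"
  "sprod P x (y - z) = sprod P x y - sprod P x z"
  "sprod P (c *\<^sub>R x) z = c * sprod P x z"
  "sprod P x (c *\<^sub>R z) = c * sprod P x z"
  "sprod P (- x) z = - sprod P x z"
  "sprod P x (- z) = - sprod P x z"
  "sprod P 0 z = 0"
  "sprod P x 0 = 0"
  by (simp_all add: linear_add[OF linear_sprod_left] linear_add[OF linear_sprod_right]
      linear_diff[OF linear_sprod_left] linear_diff[OF linear_sprod_right]
      linear_cmul[OF linear_sprod_left] linear_cmul[OF linear_sprod_right]
      linear_neg[OF linear_sprod_left] linear_neg[OF linear_sprod_right]
      linear_0[OF linear_sprod_left] linear_0[OF linear_sprod_right])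

lemma sprod_sum_left: "sprod P (\<Sum>i\<in>I. f i) z = (\<Sum>i\<in>I. sprod P (f i) z)"
  using linear_sprod_left[of P z] by (rule linear_sum)

lemma three_vectors_linear:
  assumes "\<eta> \<in> three_vectors"
  shows "linear (\<lambda>X. \<eta> X Y Z)" "linear (\<lambda>Y. \<eta> X Y Z)" "linear (\<lambda>Z. \<eta> X Y Z)"
  using assms by (auto simp: three_vectors_def)

text \<open>Polarizing the vanishing on repeated arguments gives the two transpositions; composing
  them gives the cyclic shift.\<close>

lemma three_vectors_skew:
  assumes "\<eta> \<in> three_vectors"
  shows "\<eta> Y X Z = - \<eta> X Y Z" "\<eta> X Z Y = - \<eta> X Y Z" "\<eta> Y Z X = \<eta> X Y Z"
proof -
  note lin = three_vectors_linear[OF assms]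
  have alt: "\<eta> X X Y = 0" "\<eta> X Y Y = 0" for X Y
    using assms by (auto simp: three_vectors_def)
  have s: "\<eta> Y X Z = - \<eta> X Y Z" for X Y Z
    using alt(1)[of "X + Y" Z] alt(1)[of X Z] alt(1)[of Y Z]
    by (simp add: linear_add[OF lin(1)] linear_add[OF lin(2)])
  have t: "\<eta> X Z Y = - \<eta> X Y Z" for X Y Z
    using alt(2)[of X "Y + Z"] alt(2)[of X Z] alt(2)[of X Y]
    by (simp add: linear_add[OF lin(2)] linear_add[OF lin(3)])
  show "\<eta> Y X Z = - \<eta> X Y Z" "\<eta> X Z Y = - \<eta> X Y Z" by (rule s, rule t)
  show "\<eta> Y Z X = \<eta> X Y Z" using t[of Y X Z] s[of X Y Z] by simp
qed

lemma endo_skew: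
  assumes "\<eta> \<in> three_vectors"
  shows "endo P \<eta> Y X = - endo P \<eta> X Y"
  by (rule sprod_nondegenerate[of P])
    (simp add: sprod_endo assms sprod_simps three_vectors_skew(1)[OF assms, of X Y])

lemma endo_self: "\<eta> \<in> three_vectors \<Longrightarrow> endo P \<eta> X X = 0"
  by (rule sprod_nondegenerate[of P]) (simp add: sprod_endo sprod_simps, simp add: three_vectors_def)

lemma linear_endo_right:
  assumes "\<eta> \<in> three_vectors" shows "linear (endo P \<eta> X)"
proof (rule linearI)
  note lin = three_vectors_linear[OF assms]
  show "endo P \<eta> X (Y + Z) = endo P \<eta> X Y + endo P \<eta> X Z" for Y Z
    by (rule sprod_nondegenerate[of P])
      (simp add: sprod_endo assms sprod_simps linear_add[OF lin(2)])
  show "endo P \<eta> X (c *\<^sub>R Y) = c *\<^sub>R endo P \<eta> X Y" for c Y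
    by (rule sprod_nondegenerate[of P])
      (simp add: sprod_endo assms sprod_simps linear_cmul[OF lin(2)])
qed

lemma linear_endo_left:
  assumes "\<eta> \<in> three_vectors" shows "linear (\<lambda>X. endo P \<eta> X Y)"
proof -
  have "(\<lambda>X. endo P \<eta> X Y) = (\<lambda>X. - endo P \<eta> Y X)" by (rule ext) (rule endo_skew[OF assms])
  then show ?thesis using linear_compose_neg[OF linear_endo_right[OF assms, of P Y]] by simp
qed

lemma endo_simps:
  assumes "\<eta> \<in> three_vectors"
  shows "endo P \<eta> X (Y + Z) = endo P \<eta> X Y + endo P \<eta> X Z"
    "endo P \<eta> (X + Y) Z = endo P \<eta> X Z + endo P \<eta> Y Z"
    "endo P \<eta> X (Y - Z) = endo P \<eta> X Y - endo P \<eta> X Z"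
    "endo P \<eta> (X - Y) Z = endo P \<eta> X Z - endo P \<eta> Y Z"
    "endo P \<eta> X (- Y) = - endo P \<eta> X Y"
    "endo P \<eta> (- X) Y = - endo P \<eta> X Y"
    "endo P \<eta> X 0 = 0"
    "endo P \<eta> 0 X = 0"
  using linear_endo_right[OF assms, of P X] linear_endo_left[OF assms, of P Z]
    linear_endo_left[OF assms, of P Y] linear_endo_left[OF assms, of P X]
  by (auto dest: linear_add linear_diff linear_neg linear_0)

lemma isotropic_span:
  assumes "\<And>x y. x \<in> S \<Longrightarrow> y \<in> S \<Longrightarrow> sprod P x y = 0"
  shows "isotropic P (span S)"
proof -
  \<comment> \<open>Orthogonality passes to the span in the first argument, then in the
    second.\<close>
  have "sprod P x y = 0" if "x \<in> span S" "y \<in> S" for x y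
    by (rule linear_eq_0_on_span[OF linear_sprod_left _ that(1)]) (use assms that in auto)
  then have "sprod P x y = 0" if "x \<in> span S" "y \<in> span S" for x y
    by (intro linear_eq_0_on_span[OF linear_sprod_right _ that(2)]) (use that in auto)
  then show ?thesis by (simp add: isotropic_def)
qed

lemma isotropic_subset:
  "isotropic P L \<Longrightarrow> subspace M \<Longrightarrow> M \<subseteq> L \<Longrightarrow> isotropic P M"
  by (auto simp: isotropic_def)

lemma endo_in_supp: "endo P \<eta> X Y \<in> supp P \<eta>"
  unfolding supp_def by (rule span_base) auto

text \<open>Isotropy of a span can be tested on generators. The group computations use isotropy in
  this form.\<close>

lemma CV_iff:
  "\<eta> \<in> CV P \<longleftrightarrow> \<eta> \<in> three_vectors \<and> (\<forall>X Y Z W. sprod P (endo P \<eta> X Y) (endo P \<eta> Z W) = 0)"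
  unfolding CV_def
proof (safe, goal_cases)
  case (1 X Y Z W)
  then show ?case by (auto simp: isotropic_def endo_in_supp)
next
  case 2
  show ?case unfolding supp_def by (rule isotropic_span) (use 2 in auto)
qed

lemma CV_three_vectors: "\<eta> \<in> CV P \<Longrightarrow> \<eta> \<in> three_vectors"
  by (simp add: CV_def)

text \<open>Skew symmetry moves the outer endomorphism across the scalar product, which leaves a
  pairing of two vectors of the isotropic support.\<close>

lemma endo_endo:
  assumes "\<eta> \<in> CV P"
  shows "endo P \<eta> X (endo P \<eta> Y Z) = 0" "endo P \<eta> (endo P \<eta> Y Z) X = 0"
proof -
  note \<eta> = CV_three_vectors[OF assms]
  show 1: "endo P \<eta> X (endo P \<eta> Y Z) = 0"
  proof (rule sprod_nondegenerate[of P])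
    fix W
    have "sprod P (endo P \<eta> X (endo P \<eta> Y Z)) W = - sprod P (endo P \<eta> X W) (endo P \<eta> Y Z)"
      by (simp add: sprod_endo \<eta> three_vectors_skew(2)[OF \<eta>, of X W])
    then show "sprod P (endo P \<eta> X (endo P \<eta> Y Z)) W = sprod P 0 W"
      using assms by (simp add: CV_iff sprod_simps)
  qed
  then show "endo P \<eta> (endo P \<eta> Y Z) X = 0" using endo_skew[OF \<eta>, of P X] by simp
qed


subsection \<open>Three-vectors with isotropic support\<close>

text \<open>Dimensions are bounded, so an isotropic subspace of largest dimension among those
  containing \<open>S\<close> exists; an isotropic space above it has the same dimension and equals
  it.\<close>

lemma isotropic_extend_maximal:
  assumes "isotropic P S"
  obtains L where "maximal_isotropic P L" "S \<subseteq> L"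
proof -
  let ?Q = "\<lambda>L. isotropic P L \<and> S \<subseteq> L"
  have "\<exists>L. ?Q L \<and> (\<forall>M. ?Q M \<longrightarrow> dim M \<le> dim L)"
    by (rule ex_has_greatest_nat[of ?Q S dim "Suc DIM(real^'a)"])
      (use assms in \<open>auto intro: le_imp_less_Suc dim_subset_UNIV simp del: DIM_cart\<close>)
  then obtain L where L: "?Q L" "\<And>M. ?Q M \<Longrightarrow> dim M \<le> dim L" by blast
  have "M = L" if "isotropic P M" "L \<subseteq> M" for M
    using subspace_dim_equal[of L M] L that by (auto simp: isotropic_def)
  then show ?thesis using L(1) by (intro that[of L]) (auto simp: maximal_isotropic_def)
qed

lemma Lambda3_mono: "L \<subseteq> M \<Longrightarrow> Lambda3 P L \<subseteq> Lambda3 P M"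
  unfolding Lambda3_def by blast

text \<open>
  A projection \<open>q\<close> of \<open>V\<close> onto the support, applied to the factors of a decomposition of \<open>\<eta>\<close> in
  \<open>\<Lambda>\<^sup>3V\<close>, amounts to applying the adjoint \<open>p\<close> of \<open>q\<close> to the arguments of \<open>\<eta>\<close>. That leaves \<open>\<eta>\<close>
  unchanged, because \<open>X - p X\<close> is orthogonal to the support.
\<close>

lemma in_Lambda3_supp:
  assumes \<eta>: "\<eta> \<in> three_vectors"
  shows "\<eta> \<in> Lambda3 P (supp P \<eta>)"
proof -
  have sub: "subspace (supp P \<eta>)" by (simp add: supp_def)
  \<comment> \<open>A left inverse of the identity on the support, with range in the support, is a
    projection onto it.\<close>
  obtain q where q: "range q \<subseteq> supp P \<eta>" "linear q" "\<And>v. v \<in> supp P \<eta> \<Longrightarrow> q v = v"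
    using linear_exists_left_inverse_on[OF linear_id sub] by auto
  have "\<exists>v. \<forall>x. sprod P v x = sprod P (q x) Y" for Y
    using riesz_sprod[OF linear_compose[OF q(2) linear_sprod_left, unfolded o_def], of P P Y] by blast
  then obtain p where p: "\<And>x Y. sprod P (p Y) x = sprod P (q x) Y" by metis
  have drop: "\<eta> X Y (p Z) = \<eta> X Y Z" for X Y Z
  proof -
    have "sprod P (endo P \<eta> X Y) (p Z) = sprod P (endo P \<eta> X Y) Z"
      using p[of Z "endo P \<eta> X Y"] by (simp add: q(3) endo_in_supp sprod_commute)
    then show ?thesis by (simp add: sprod_endo \<eta>)
  qed
  \<comment> \<open>Cyclic shifts bring each argument in turn to the last slot, where
    \<open>drop\<close> removes \<open>p\<close>.\<close>
  have pull: "\<eta> (p X) (p Y) (p Z) = \<eta> X Y Z" for X Y Z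
    using drop three_vectors_skew(3)[OF \<eta>] by metis
  obtain m :: nat and c x y z
    where dec: "\<eta> = (\<lambda>X Y Z. \<Sum>i<m. c i * wedge3 P (x i) (y i) (z i) X Y Z)"
    using \<eta> unfolding Lambda3_UNIV[of P, symmetric] by (auto simp: Lambda3_def)
  have "wedge3 P x y z (p X) (p Y) (p Z) = wedge3 P (q x) (q y) (q z) X Y Z" for x y z X Y Z
    using p by (simp add: wedge3_def sprod_commute[of P _ "p _"])
  then have "\<eta> (p X) (p Y) (p Z) = (\<Sum>i<m. c i * wedge3 P (q (x i)) (q (y i)) (q (z i)) X Y Z)"
    for X Y Z by (simp add: dec)
  then have "\<eta> = (\<lambda>X Y Z. \<Sum>i<m. c i * wedge3 P (q (x i)) (q (y i)) (q (z i)) X Y Z)"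
    by (intro ext) (simp add: pull)
  then show ?thesis
    unfolding Lambda3_def
    using q(1) by (intro CollectI exI[of _ m] exI[of _ c] exI[of _ "\<lambda>i. q (x i)"]
        exI[of _ "\<lambda>i. q (y i)"] exI[of _ "\<lambda>i. q (z i)"]) auto
qed

lemma supp_Lambda3:
  assumes "\<eta> \<in> Lambda3 P L" "subspace L"
  shows "supp P \<eta> \<subseteq> L"
proof -
  obtain m :: nat and c x y z
    where L: "\<forall>i<m. x i \<in> L \<and> y i \<in> L \<and> z i \<in> L"
      and \<eta>: "\<eta> = (\<lambda>X Y Z. \<Sum>i<m. c i * wedge3 P (x i) (y i) (z i) X Y Z)"
    using assms(1) by (auto simp: Lambda3_def)
  have tv: "\<eta> \<in> three_vectors"
    using assms(1) Lambda3_mono[of L UNIV P] Lambda3_UNIV[of P] by auto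
  \<comment> \<open>The coefficients are the cofactors of the third column of the determinant in
    \<open>wedge3\<close>, the only column that depends on \<open>Z\<close>.\<close>
  let ?w = "\<lambda>x y z X Y. (sprod P x X * sprod P y Y - sprod P x Y * sprod P y X) *\<^sub>R z
    + (sprod P x Y * sprod P z X - sprod P x X * sprod P z Y) *\<^sub>R y
    + (sprod P y X * sprod P z Y - sprod P y Y * sprod P z X) *\<^sub>R x"
  have "endo P \<eta> X Y = (\<Sum>i<m. c i *\<^sub>R ?w (x i) (y i) (z i) X Y)" for X Y
  proof (rule sprod_nondegenerate[of P])
    fix Z
    have "wedge3 P x y z X Y Z = sprod P (?w x y z X Y) Z" for x y z
      by (simp add: wedge3_def det_3 sprod_simps algebra_simps)
    then show "sprod P (endo P \<eta> X Y) Z = sprod P (\<Sum>i<m. c i *\<^sub>R ?w (x i) (y i) (z i) X Y) Z"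
      unfolding sprod_endo[OF tv] sprod_sum_left sprod_simps(5) by (simp add: \<eta>)
  qed
  then have "endo P \<eta> X Y \<in> L" for X Y
    using L assms(2)
    by (auto intro!: subspace_sum subspace_add subspace_scale simp del: scaleR_add_right)
  then show ?thesis
    unfolding supp_def using assms(2) by (intro span_minimal) auto
qed

lemma CV_eq_Union: "CV P = (\<Union>L\<in>{L. maximal_isotropic P L}. Lambda3 P L)"
proof (intro equalityI subsetI)
  fix \<eta> assume "\<eta> \<in> CV P"
  then have \<eta>: "\<eta> \<in> three_vectors" "isotropic P (supp P \<eta>)" by (auto simp: CV_def)
  from isotropic_extend_maximal[OF \<eta>(2)] obtain L where "maximal_isotropic P L" "supp P \<eta> \<subseteq> L" .
  then show "\<eta> \<in> (\<Union>L\<in>{L. maximal_isotropic P L}. Lambda3 P L)"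
    using in_Lambda3_supp[OF \<eta>(1), of P] Lambda3_mono by blast
next
  fix \<eta> assume "\<eta> \<in> (\<Union>L\<in>{L. maximal_isotropic P L}. Lambda3 P L)"
  then obtain L where L: "isotropic P L" "\<eta> \<in> Lambda3 P L" by (auto simp: maximal_isotropic_def)
  then have "supp P \<eta> \<subseteq> L" by (intro supp_Lambda3) (auto simp: isotropic_def)
  then have "isotropic P (supp P \<eta>)"
    by (intro isotropic_subset[OF L(1)]) (simp_all add: supp_def)
  moreover have "\<eta> \<in> three_vectors"
    using L(2) Lambda3_mono[of L UNIV P] Lambda3_UNIV[of P] by auto
  ultimately show "\<eta> \<in> CV P" by (simp add: CV_def)
qed


subsection \<open>The group of a three-vector\<close>

lemma gmap_comp:
  assumes "\<eta> \<in> CV P"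
  shows "gmap P \<eta> X \<circ> gmap P \<eta> Y = gmap P \<eta> (X + Y + endo P \<eta> X Y)"
  using CV_three_vectors[OF assms]
  by (simp add: fun_eq_iff gmap_eq[OF assms] endo_simps endo_endo[OF assms] algebra_simps)

lemma gmap_zero: "\<eta> \<in> CV P \<Longrightarrow> gmap P \<eta> 0 = id"
  by (simp add: fun_eq_iff gmap_eq endo_simps CV_three_vectors)

lemma gmap_at_zero: "\<eta> \<in> CV P \<Longrightarrow> gmap P \<eta> X 0 = X"
  by (simp add: gmap_eq endo_simps CV_three_vectors)

lemma affine_in_Isom:
  "A \<in> pseudo_orthogonal P \<Longrightarrow> (\<lambda>x. A x + v) \<in> carrier (Isom P)"
  unfolding Isom_def partial_object.simps mem_Collect_eq
  by (intro exI[of _ A] exI[of _ v] conjI refl)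

text \<open>For the linear part \<open>1 + e\<^sub>X\<close>, the mixed terms cancel by skew
  symmetry and the quadratic term vanishes by isotropy.\<close>

lemma gmap_in_Isom:
  assumes "\<eta> \<in> CV P" shows "gmap P \<eta> X \<in> carrier (Isom P)"
proof -
  note \<eta> = CV_three_vectors[OF assms]
  let ?A = "\<lambda>x. x + endo P \<eta> X x"
  have "linear ?A" by (intro linear_compose_add linear_ident linear_endo_right \<eta>)
  moreover have "sprod P (?A x) (?A y) = sprod P x y" for x y
    using assms three_vectors_skew(2)[OF \<eta>, of X x y]
    by (simp add: sprod_simps sprod_endo \<eta> sprod_commute[of P x "endo P \<eta> X y"] CV_iff)
  ultimately have "?A \<in> pseudo_orthogonal P" by (simp add: pseudo_orthogonal_def)
  then show ?thesis
    unfolding gmap_eq[OF assms, abs_def] by (rule affine_in_Isom)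
qed

lemma Isom_simps [simp]: "f \<otimes>\<^bsub>Isom P\<^esub> g = f \<circ> g" "\<one>\<^bsub>Isom P\<^esub> = id"
  by (simp_all add: Isom_def)

text \<open>The parameters \<open>- X\<close> and \<open>X\<close> compose to zero because
  \<open>endo P \<eta> X X\<close> vanishes.\<close>

lemma inv_gmap:
  assumes "\<eta> \<in> CV P" shows "inv\<^bsub>Isom P\<^esub> (gmap P \<eta> X) = gmap P \<eta> (- X)"
proof (rule group.inv_equality[OF group_Isom])
  show "gmap P \<eta> (- X) \<otimes>\<^bsub>Isom P\<^esub> gmap P \<eta> X = \<one>\<^bsub>Isom P\<^esub>"
    using CV_three_vectors[OF assms]
    by (simp add: gmap_comp[OF assms] endo_simps endo_self gmap_zero[OF assms])
qed (simp_all add: gmap_in_Isom assms)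

lemma subgroup_LL:
  assumes "\<eta> \<in> CV P" shows "subgroup (LL P \<eta>) (Isom P)"
  by (rule group.subgroupI[OF group_Isom])
    (auto simp: LL_def gmap_in_Isom inv_gmap gmap_comp assms)

lemma two_step_nilpotent_LL:
  assumes "\<eta> \<in> CV P" shows "two_step_nilpotent (Isom P) (LL P \<eta>)"
proof -
  note \<eta> = CV_three_vectors[OF assms]
  \<comment> \<open>the simplifier turns \<open>v + v\<close> into the componentwise product \<open>2 * v\<close>\<close>
  have double: "endo P \<eta> (2 * endo P \<eta> X Y) Z = 0" "endo P \<eta> Z (2 * endo P \<eta> X Y) = 0" for X Y Z
    unfolding mult_2 by (simp_all only: endo_simps(1,2)[OF \<eta>] endo_endo[OF assms] add_0)
  have comm: "gmap P \<eta> X \<otimes>\<^bsub>Isom P\<^esub> gmap P \<eta> Y \<otimes>\<^bsub>Isom P\<^esub> inv\<^bsub>Isom P\<^esub> gmap P \<eta> X \<otimes>\<^bsub>Isom P\<^esub>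
      inv\<^bsub>Isom P\<^esub> gmap P \<eta> Y = gmap P \<eta> (endo P \<eta> X Y + endo P \<eta> X Y)" for X Y
    by (simp add: inv_gmap assms gmap_comp endo_simps endo_self \<eta> endo_endo[OF assms]
        endo_skew[OF \<eta>, of P Y X] double)
  \<comment> \<open>The bracket term in \<open>gmap_comp\<close> vanishes in either order, so the
    parameters merely add.\<close>
  have "gmap P \<eta> (endo P \<eta> X Y + endo P \<eta> X Y) \<circ> gmap P \<eta> Z =
      gmap P \<eta> Z \<circ> gmap P \<eta> (endo P \<eta> X Y + endo P \<eta> X Y)" for X Y Z
    by (simp add: gmap_comp assms double add.commute)
  then show ?thesis
    by (auto simp: two_step_nilpotent_def LL_def comm simp del: Isom_simps(1)) simp
qed

lemma simply_transitive_LL: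
  assumes "\<eta> \<in> CV P" shows "simply_transitive (LL P \<eta>)"
  unfolding simply_transitive_def
proof (intro allI ex_ex1I)
  note \<eta> = CV_three_vectors[OF assms]
  fix x y
  let ?X = "(y - x) + endo P \<eta> x (y - x)"
  have "gmap P \<eta> ?X x = y"
    using endo_skew[OF \<eta>, of P x y]
    by (simp add: gmap_eq assms endo_simps \<eta> endo_endo[OF assms] endo_self)
  then show "\<exists>g. g \<in> LL P \<eta> \<and> g x = y" by (auto simp: LL_def)
  fix g h assume "g \<in> LL P \<eta> \<and> g x = y" "h \<in> LL P \<eta> \<and> h x = y"
  then obtain X Y where X: "g = gmap P \<eta> X" "gmap P \<eta> X x = y"
    and Y: "h = gmap P \<eta> Y" "gmap P \<eta> Y x = y" by (auto simp: LL_def)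
  have eq: "endo P \<eta> X x + X = endo P \<eta> Y x + Y"
    using X(2) Y(2) by (auto simp: gmap_eq assms add.assoc)
  \<comment> \<open>The nested term dies by \<open>endo_endo\<close>, which isolates
    \<open>endo P \<eta> X x\<close> and then the parameter itself.\<close>
  then have "endo P \<eta> (endo P \<eta> X x + X) x = endo P \<eta> (endo P \<eta> Y x + Y) x" by simp
  then have "endo P \<eta> X x = endo P \<eta> Y x" by (simp add: endo_simps \<eta> endo_endo[OF assms])
  then show "g = h" using eq X Y by simp
qed


subsection \<open>Conjugacy\<close>

lemma act_in_CV:
  assumes \<eta>: "\<eta> \<in> CV P" and A: "A \<in> pseudo_orthogonal P"
  shows "act A \<eta> \<in> CV P"
proof -
  have "linear (Hilbert_Choice.inv A)"
    using pseudo_orthogonal_inv[OF A] by (simp add: pseudo_orthogonal_def)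
  then have "act A \<eta> \<in> three_vectors"
    using CV_three_vectors[OF \<eta>] unfolding three_vectors_def act_def
    by (auto intro: linear_compose[of "Hilbert_Choice.inv A", unfolded o_def])
  then show ?thesis
    using \<eta> A by (auto simp: CV_iff endo_act pseudo_orthogonal_def)
qed

text \<open>The correction \<open>endo P (act A \<eta>) v (A X)\<close> cancels the term that the
  linear part on the right produces from the translation \<open>v\<close>.\<close>

lemma gmap_conjugate:
  assumes \<eta>: "\<eta> \<in> CV P" and A: "A \<in> pseudo_orthogonal P" and f: "f = (\<lambda>x. A x + v)"
  shows "f \<circ> gmap P \<eta> X = gmap P (act A \<eta>) (A X + endo P (act A \<eta>) v (A X)) \<circ> f"
proof
  fix x
  note tv = CV_three_vectors[OF \<eta>]
  note \<eta>' = act_in_CV[OF \<eta> A]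
  note tv' = CV_three_vectors[OF \<eta>']
  have lin: "linear A" using A by (simp add: pseudo_orthogonal_def)
  have "A (endo P \<eta> X x) = endo P (act A \<eta>) (A X) (A x)"
    using pseudo_orthogonal_bij[OF A] by (simp add: endo_act tv A bij_is_inj)
  then show "(f \<circ> gmap P \<eta> X) x = (gmap P (act A \<eta>) (A X + endo P (act A \<eta>) v (A X)) \<circ> f) x"
    using endo_skew[OF tv', of P v "A X"]
    by (simp add: f gmap_eq \<eta> \<eta>' linear_add[OF lin] endo_simps tv' endo_endo[OF \<eta>'])
qed

lemma LL_conjugate:
  assumes \<eta>: "\<eta> \<in> CV P" and A: "A \<in> pseudo_orthogonal P" and f: "f = (\<lambda>x. A x + v)"
  shows "(\<lambda>h. f \<otimes>\<^bsub>Isom P\<^esub> h \<otimes>\<^bsub>Isom P\<^esub> inv\<^bsub>Isom P\<^esub> f) ` LL P \<eta> = LL P (act A \<eta>)"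
proof -
  note \<eta>' = act_in_CV[OF \<eta> A]
  note tv' = CV_three_vectors[OF \<eta>']
  have fc: "f \<in> carrier (Isom P)" unfolding f by (rule affine_in_Isom[OF A])
  let ?t = "\<lambda>X. A X + endo P (act A \<eta>) v (A X)"
  have conj: "f \<otimes>\<^bsub>Isom P\<^esub> gmap P \<eta> X \<otimes>\<^bsub>Isom P\<^esub> inv\<^bsub>Isom P\<^esub> f = gmap P (act A \<eta>) (?t X)" for X
  proof (rule sym, subst group.inv_solve_right[OF group_Isom])
    show "f \<otimes>\<^bsub>Isom P\<^esub> gmap P \<eta> X \<in> carrier (Isom P)"
      using group.is_monoid[OF group_Isom] fc gmap_in_Isom[OF \<eta>] by (rule monoid.m_closed)
    show "f \<otimes>\<^bsub>Isom P\<^esub> gmap P \<eta> X = gmap P (act A \<eta>) (?t X) \<otimes>\<^bsub>Isom P\<^esub> f"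
      using gmap_conjugate[OF \<eta> A f] by simp
  qed (simp_all add: fc gmap_in_Isom \<eta>')
  \<comment> \<open>The map \<open>?t\<close> is \<open>1 + e\<^sub>v\<close> after
    \<open>A\<close>, with \<open>e\<^sub>v\<close> taken for \<open>act A \<eta>\<close>; since
    \<open>e\<^sub>v\<close> squares to zero, \<open>1 - e\<^sub>v\<close> inverts the first
    factor.\<close>
  have "W \<in> range ?t" for W
  proof -
    obtain X where "A X = W - endo P (act A \<eta>) v W"
      using pseudo_orthogonal_bij[OF A] by (metis bij_pointE)
    then have "?t X = W" by (simp add: endo_simps tv' endo_endo[OF \<eta>'])
    then show ?thesis by (rule range_eqI[OF sym])
  qed
  then have "range ?t = UNIV" by blast
  then have "range (\<lambda>X. gmap P (act A \<eta>) (?t X)) = range (gmap P (act A \<eta>))"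
    by (simp only: image_image[symmetric, of "gmap P (act A \<eta>)" ?t])
  then show ?thesis by (simp only: LL_def image_image conj)
qed

lemma LL_inj:
  assumes "\<eta> \<in> CV P" "\<eta>' \<in> CV P" "LL P \<eta> = LL P \<eta>'"
  shows "\<eta> = \<eta>'"
proof (intro ext)
  fix X Y Z
  have "gmap P \<eta> X \<in> LL P \<eta>'" by (subst assms(3)[symmetric]) (simp add: LL_def)
  then obtain X' where X': "gmap P \<eta> X = gmap P \<eta>' X'" by (auto simp: LL_def)
  then have "X = X'"
    using gmap_at_zero[OF assms(1), of X] gmap_at_zero[OF assms(2), of X'] by simp
  with X' have "endo P \<eta> X Y = endo P \<eta>' X Y"
    using gmap_eq[OF assms(1), of X Y] gmap_eq[OF assms(2), of X Y] by simp
  then show "\<eta> X Y Z = \<eta>' X Y Z"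
    using sprod_endo[OF CV_three_vectors[OF assms(1)], of P X Y Z]
      sprod_endo[OF CV_three_vectors[OF assms(2)], of P X Y Z] by simp
qed

lemma conjugate_LL_iff:
  assumes "\<eta> \<in> CV P" "\<eta>' \<in> CV P"
  shows "conjugate_in (Isom P) (LL P \<eta>) (LL P \<eta>') \<longleftrightarrow> (\<exists>g\<in>pseudo_orthogonal P. \<eta>' = act g \<eta>)"
proof
  assume "conjugate_in (Isom P) (LL P \<eta>) (LL P \<eta>')"
  then obtain f where f: "f \<in> carrier (Isom P)"
    "LL P \<eta>' = (\<lambda>h. f \<otimes>\<^bsub>Isom P\<^esub> h \<otimes>\<^bsub>Isom P\<^esub> inv\<^bsub>Isom P\<^esub> f) ` LL P \<eta>"
    unfolding conjugate_in_def by blast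
  from f(1) obtain A v where A: "A \<in> pseudo_orthogonal P" "f = (\<lambda>x. A x + v)"
    unfolding Isom_def by auto
  \<comment> \<open>The conjugate subgroup depends only on the linear part \<open>A\<close>, not on
    \<open>v\<close>.\<close>
  have "LL P \<eta>' = LL P (act A \<eta>)" unfolding f(2) by (rule LL_conjugate[OF assms(1) A])
  then show "\<exists>g\<in>pseudo_orthogonal P. \<eta>' = act g \<eta>"
    using LL_inj[OF assms(2) act_in_CV[OF assms(1) A(1)]] A(1) by blast
next
  assume "\<exists>g\<in>pseudo_orthogonal P. \<eta>' = act g \<eta>"
  then obtain g where g: "g \<in> pseudo_orthogonal P" "\<eta>' = act g \<eta>" by blast
  show "conjugate_in (Isom P) (LL P \<eta>) (LL P \<eta>')"
    unfolding conjugate_in_def g(2)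
    by (intro bexI[where x = "\<lambda>x. g x + 0"] LL_conjugate[OF assms(1) g(1) refl, symmetric]
        affine_in_Isom g(1))
qed

theorem theorem1:
  fixes P :: "'n::finite set" and k l :: nat
  assumes "card P = k" and "card (- P) = l"
  shows "CV P = (\<Union>L\<in>{L. maximal_isotropic P L}. Lambda3 P L)
    \<and> (\<forall>\<eta>\<in>CV P. subgroup (LL P \<eta>) (Isom P)
          \<and> two_step_nilpotent (Isom P) (LL P \<eta>)
          \<and> simply_transitive (LL P \<eta>))
    \<and> (\<forall>\<eta>\<in>CV P. \<forall>\<eta>'\<in>CV P.
          conjugate_in (Isom P) (LL P \<eta>) (LL P \<eta>')
            \<longleftrightarrow> (\<exists>g\<in>pseudo_orthogonal P. \<eta>' = act g \<eta>))"
  by (intro conjI ballI CV_eq_Union subgroup_LL two_step_nilpotent_LL simply_transitive_LL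
      conjugate_LL_iff)

end
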